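(* For every probability measure $\mu$ on $\mathbb{R}$ there exists a probability measure $\eta$ on $\mathbb{R}$ such that the convolution $\ddot\mu := \mu * \eta$ has a symmetric distribution function $F_{\ddot\mu} = F_\mu * F_\eta$ and a symmetric characteristic function $\Phi_{\ddot\mu} = \Phi_\mu \Phi_\eta$ with $0 \le \Phi_{\ddot\mu}(t) \le 1$ for all $t\in\mathbb{R}$ and $\mathcal{N}_{\ddot\mu} = \mathcal{N}_\mu$.
   Context: Measures are Borel measures on $\mathbb{R}$. For a probability measure $\nu$: $F_\nu(\xi) := \nu((-\infty,\xi])$ is its distribution function, $\Phi_\nu(t) := \int_{-\infty}^\infty e^{itx}\,\nu(dx)$ its characteristic function, and $\mathcal{N}_\nu := \{t \in \mathbb{R}\cup\{\pm\infty\} : \Phi_\nu(t) = 0\}$, where $\Phi_\nu(\pm\infty):=\lim_{t\to\pm\infty}\Phi_\nu(t)$ if this limit exists (so $\pm\infty\in\mathcal{N}_\nu$ means that the limit exists and is $0$). $(F_{\nu_1} * F_{\nu_2})(\xi) := \int_{\mathbb{R}} F_{\nu_1}(\xi-x) F_{\nu_2}(dx)$ is the distribution function of $\nu_1 * \nu_2$. The distribution function is symmetric if $F_\nu(\xi-) = 1-F_\nu(-\xi)$ for all $\xi \in \mathbb{R}$ (with $F_\nu(\xi-)$ the left limit); the characteristic function is symmetric if it is even. *)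

theory Defs
  imports "HOL-Probability.Probability"
begin

(* Convolution of distribution functions. The second argument enters only through the
   Lebesgue-Stieltjes measure it generates, i.e. this is the integral of F (\<xi> - x) against G(dx). *)
definition df_convolution :: "(real \<Rightarrow> real) \<Rightarrow> (real \<Rightarrow> real) \<Rightarrow> real \<Rightarrow> real" where
  "df_convolution F G \<xi> = (LINT x|interval_measure G. F (\<xi> - x))"

(* The left limit F(\<xi>-) is expressed as a one-sided limit. *)
definition symmetric_df :: "(real \<Rightarrow> real) \<Rightarrow> bool" where
  "symmetric_df F \<longleftrightarrow> (\<forall>\<xi>. (F \<longlongrightarrow> 1 - F (- \<xi>)) (at_left \<xi>))"

definition symmetric_cf :: "(real \<Rightarrow> complex) \<Rightarrow> bool" where
  "symmetric_cf \<Phi> \<longleftrightarrow> (\<forall>t. \<Phi> (- t) = \<Phi> t)"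

(* The zeros of the characteristic function in the extended reals: plus or minus infinity is a
   zero iff the corresponding limit exists and equals 0. *)
definition char_zeros :: "real measure \<Rightarrow> ereal set" where
  "char_zeros \<nu> = {t. (\<exists>r. t = ereal r \<and> char \<nu> r = 0) \<or>
     (t = \<infinity> \<and> (char \<nu> \<longlongrightarrow> 0) at_top) \<or>
     (t = - \<infinity> \<and> (char \<nu> \<longlongrightarrow> 0) at_bot)}"

end

theory Submission
  imports Defs
begin

text \<open>
  The measure \<open>\<eta>\<close> is the reflection of \<open>\<mu>\<close> at the origin, that is, the law of \<open>-X\<close> for \<open>X\<close>
  distributed as \<open>\<mu>\<close>. Then \<open>\<mu> \<star> \<eta>\<close> is the law of \<open>X - X'\<close> with \<open>X'\<close> an independent copy of
  \<open>X\<close>. Reflection conjugates the characteristic function, so \<open>\<Phi>\<^sub>\<mu> \<Phi>\<^sub>\<eta> = \<bar>\<Phi>\<^sub>\<mu>\<bar>\<^sup>2\<close>. This function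
  takes values in \<open>[0, 1]\<close>, and it vanishes at a point, or tends to \<open>0\<close> at plus or minus infinity,
  exactly when \<open>\<Phi>\<^sub>\<mu>\<close> does. Being real, it is even, because \<open>\<Phi>(-t)\<close> is always the conjugate of
  \<open>\<Phi>(t)\<close>; and a measure with real characteristic function equals its own reflection by the
  uniqueness theorem for characteristic functions, which gives the symmetry of the distribution
  function of \<open>\<mu> \<star> \<eta>\<close>.
\<close>

section \<open>Convolution of real distributions\<close>

lemma real_distribution_convolution:
  assumes "real_distribution M" "real_distribution N"
  shows "real_distribution (M \<star> N)"
proof -
  interpret M: real_distribution M by fact
  interpret N: real_distribution N by fact
  interpret P: pair_prob_space M N ..
  show ?thesis
    unfolding convolution_def by (rule P.real_distribution_distr) measurable
qed

lemma char_convolution: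
  assumes "real_distribution M" "real_distribution N"
  shows "char (M \<star> N) t = char M t * char N t"
proof -
  interpret M: real_distribution M by fact
  interpret N: real_distribution N by fact
  interpret P: pair_prob_space M N ..
  have int: "integrable (M \<Otimes>\<^sub>M N) (\<lambda>p. iexp (t * (fst p + snd p)))"
    by (rule P.integrable_iexp) auto
  have "char (M \<star> N) t = (CLINT p|M \<Otimes>\<^sub>M N. iexp (t * (fst p + snd p)))"
    unfolding char_def convolution_def
    by (subst integral_distr) (auto simp: case_prod_beta)
  also have "\<dots> = (CLINT x|M. CLINT y|N. iexp (t * (x + y)))"
    using P.integral_fst'[OF int] by simp
  also have "\<dots> = (CLINT x|M. CLINT y|N. iexp (t * x) * iexp (t * y))"
    by (simp add: distrib_left exp_add)
  also have "\<dots> = char M t * char N t"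
    by (simp add: char_def)
  finally show ?thesis .
qed

text \<open>
  The integral in \<^const>\<open>df_convolution\<close> is taken against the Lebesgue-Stieltjes measure of the
  second distribution function, which is the second measure itself. What remains is Tonelli's
  theorem for the event \<open>x + y \<le> \<xi>\<close>.
\<close>

lemma cdf_convolution:
  assumes "real_distribution M" "real_distribution N"
  shows "cdf (M \<star> N) = df_convolution (cdf M) (cdf N)"
proof
  fix \<xi>
  interpret M: real_distribution M by fact
  interpret N: real_distribution N by fact
  interpret C: real_distribution "M \<star> N"
    by (rule real_distribution_convolution) fact+
  have stieltjes: "interval_measure (cdf N) = N"
    by (intro cdf_unique real_distribution_interval_measure cdf_interval_measure
        N.cdf_nondecreasing N.cdf_is_right_cont N.cdf_lim_at_bot N.cdf_lim_at_top_prob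
        N.real_distribution_axioms)
  have [measurable]: "cdf M \<in> borel_measurable borel"
    by (intro borel_measurable_mono monoI M.cdf_nondecreasing)
  have int: "integrable N (\<lambda>x. cdf M (\<xi> - x))"
    by (intro N.integrable_const_bound[of _ 1])
       (auto simp: M.cdf_nonneg M.cdf_bounded_prob)
  have "ennreal (cdf (M \<star> N) \<xi>) = emeasure (N \<star> M) {..\<xi>}"
    unfolding cdf_def C.emeasure_eq_measure[symmetric]
    by (subst convolution_commutative)
       (auto intro: M.finite_measure_axioms N.finite_measure_axioms)
  also have "\<dots> = (\<integral>\<^sup>+x. emeasure M {a. a + x \<in> {..\<xi>}} \<partial>N)"
    by (rule convolution_emeasure)
       (auto intro: M.finite_measure_axioms N.finite_measure_axioms)
  also have "\<dots> = (\<integral>\<^sup>+x. ennreal (cdf M (\<xi> - x)) \<partial>N)"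
  proof (rule nn_integral_cong)
    fix x
    have "{a. a + x \<in> {..\<xi>}} = {..\<xi> - x}" by (auto simp: algebra_simps)
    then show "emeasure M {a. a + x \<in> {..\<xi>}} = ennreal (cdf M (\<xi> - x))"
      by (simp add: cdf_def M.emeasure_eq_measure)
  qed
  also have "\<dots> = ennreal (LINT x|N. cdf M (\<xi> - x))"
    by (rule nn_integral_eq_integral[OF int]) (simp add: M.cdf_nonneg)
  finally have "cdf (M \<star> N) \<xi> = (LINT x|N. cdf M (\<xi> - x))"
    by (simp add: C.cdf_nonneg M.cdf_nonneg integral_nonneg_AE)
  then show "cdf (M \<star> N) \<xi> = df_convolution (cdf M) (cdf N) \<xi>"
    by (simp add: df_convolution_def stieltjes)
qed

section \<open>Reflection and symmetry\<close>

lemma real_distribution_reflection: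
  assumes "real_distribution M"
  shows "real_distribution (distr M borel uminus)"
proof -
  interpret M: real_distribution M by fact
  show ?thesis by (rule M.real_distribution_distr) simp
qed

lemma char_uminus_eq_cnj: "char M (- t) = cnj (char M t)"
  unfolding char_def by (simp add: exp_cnj flip: Bochner_Integration.integral_cnj)

lemma char_reflection:
  assumes "real_distribution M"
  shows "char (distr M borel uminus) t = cnj (char M t)"
proof -
  interpret M: real_distribution M by fact
  have "char (distr M borel uminus) t = char M (- t)"
    unfolding char_def by (subst integral_distr) auto
  then show ?thesis by (simp add: char_uminus_eq_cnj)
qed

lemma symmetric_cf_if_char_real:
  assumes "\<And>t. char M t \<in> \<real>"
  shows "symmetric_cf (char M)"
  using assms by (simp add: symmetric_cf_def char_uminus_eq_cnj Reals_cnj_iff)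

text \<open>
  By uniqueness of characteristic functions such a measure is invariant under reflection, so the
  mass \<open>F(\<xi>-)\<close> of \<open>(-\<infinity>, \<xi>)\<close> equals the mass of the mirror image \<open>(-\<xi>, \<infinity>)\<close>.
\<close>

lemma symmetric_df_if_char_real:
  assumes "real_distribution M" and real: "\<And>t. char M t \<in> \<real>"
  shows "symmetric_df (cdf M)"
  unfolding symmetric_df_def
proof
  fix \<xi>
  interpret M: real_distribution M by fact
  have "distr M borel uminus = M"
    using real
    by (intro Levy_uniqueness real_distribution_reflection assms(1) ext)
       (simp add: char_reflection[OF assms(1)] Reals_cnj_iff)
  then have "measure M {..<\<xi>} = measure (distr M borel uminus) {..<\<xi>}"
    by simp
  also have "\<dots> = measure M (uminus -` {..<\<xi>})"
    by (subst measure_distr) auto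
  also have "uminus -` {..<\<xi>} = space M - {..- \<xi>}"
    by auto
  also have "measure M \<dots> = 1 - cdf M (- \<xi>)"
    unfolding cdf_def by (rule M.prob_compl) simp
  finally show "(cdf M \<longlongrightarrow> 1 - cdf M (- \<xi>)) (at_left \<xi>)"
    using M.cdf_at_left[of \<xi>] by simp
qed

text \<open>
  The zeros at plus and minus infinity depend only on the modulus of the characteristic function,
  so squaring the modulus preserves them as well.
\<close>

lemma char_zeros_eq_if_norm_square:
  assumes "\<And>t. char N t = of_real ((norm (char M t))\<^sup>2)"
  shows "char_zeros N = char_zeros M"
proof -
  have lim: "(char N \<longlongrightarrow> 0) F \<longleftrightarrow> (char M \<longlongrightarrow> 0) F" for F
  proof -
    have "(char N \<longlongrightarrow> 0) F \<longleftrightarrow> ((\<lambda>t. (norm (char M t))\<^sup>2) \<longlongrightarrow> 0) F"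
      by (subst tendsto_norm_zero_iff[symmetric]) (simp add: assms norm_power)
    also have "\<dots> \<longleftrightarrow> ((\<lambda>t. norm (char M t)) \<longlongrightarrow> 0) F"
    proof
      assume "((\<lambda>t. (norm (char M t))\<^sup>2) \<longlongrightarrow> 0) F"
      then show "((\<lambda>t. norm (char M t)) \<longlongrightarrow> 0) F"
        using tendsto_real_sqrt by fastforce
    next
      assume "((\<lambda>t. norm (char M t)) \<longlongrightarrow> 0) F"
      then show "((\<lambda>t. (norm (char M t))\<^sup>2) \<longlongrightarrow> 0) F"
        by (rule tendsto_null_power) simp
    qed
    also have "\<dots> \<longleftrightarrow> (char M \<longlongrightarrow> 0) F"
      by (rule tendsto_norm_zero_iff)
    finally show ?thesis .
  qed
  have "char N r = 0 \<longleftrightarrow> char M r = 0" for r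
    by (simp add: assms)
  then show ?thesis
    unfolding char_zeros_def by (simp add: lim)
qed

section \<open>Symmetrization\<close>

theorem lemma3p1:
  fixes \<mu> :: "real measure"
  assumes "real_distribution \<mu>"
  shows "\<exists>\<eta> :: real measure. real_distribution \<eta> \<and>
    symmetric_df (cdf (\<mu> \<star> \<eta>)) \<and>
    cdf (\<mu> \<star> \<eta>) = df_convolution (cdf \<mu>) (cdf \<eta>) \<and>
    symmetric_cf (char (\<mu> \<star> \<eta>)) \<and>
    char (\<mu> \<star> \<eta>) = (\<lambda>t. char \<mu> t * char \<eta> t) \<and>
    (\<forall>t. char (\<mu> \<star> \<eta>) t \<in> \<real> \<and> 0 \<le> Re (char (\<mu> \<star> \<eta>) t) \<and> Re (char (\<mu> \<star> \<eta>) t) \<le> 1) \<and>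
    char_zeros (\<mu> \<star> \<eta>) = char_zeros \<mu>"
proof -
  interpret \<mu>: real_distribution \<mu> by fact
  define \<eta> where "\<eta> = distr \<mu> borel uminus"
  have \<eta>: "real_distribution \<eta>"
    unfolding \<eta>_def by (rule real_distribution_reflection) fact
  note conv = real_distribution_convolution[OF assms \<eta>]
  have char_eq: "char (\<mu> \<star> \<eta>) t = of_real ((norm (char \<mu> t))\<^sup>2)" for t
    unfolding char_convolution[OF assms \<eta>] unfolding \<eta>_def char_reflection[OF assms]
    by (rule complex_norm_square[symmetric])
  then have real: "char (\<mu> \<star> \<eta>) t \<in> \<real>" for t
    by (metis Reals_of_real)
  have bounds: "0 \<le> Re (char (\<mu> \<star> \<eta>) t) \<and> Re (char (\<mu> \<star> \<eta>) t) \<le> 1" for t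
    using \<mu>.cmod_char_le_1[of t] unfolding char_eq Re_complex_of_real by (simp add: power_le_one)
  show ?thesis
    using \<eta> symmetric_df_if_char_real[OF conv real] cdf_convolution[OF assms \<eta>]
      symmetric_cf_if_char_real[OF real] char_convolution[OF assms \<eta>] real bounds
      char_zeros_eq_if_norm_square[OF char_eq]
    by blast
qed

end
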